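(* Let $\mathcal{A}$ be a unital Banach algebra, let $n\geq 1$ be an integer, and let $a_0,a_1,\dots,a_{n-1}\in\mathcal{A}$. Let $p(z)=a_0+a_1z+\cdots+a_{n-1}z^{n-1}+z^n\in\mathcal{A}[z]$. Let $u\in\mathcal{A}$ be such that $p(u)=0$ and $u$ is invertible. Then $$\frac{1}{\|u^{-1}\|}\leq\max\left\{1,\sum_{j=0}^{n-1}\|a_j\|\right\}.$$
   Context: Here $\mathcal{A}$ is a (possibly noncommutative) Banach algebra with unit $1\neq 0$, and $\mathcal{A}[z]$ is the set of polynomials over $\mathcal{A}$. Coefficients are written on the left of the powers of $z$, and $p(u)$ means $p(u)=a_0+a_1u+\cdots+a_{n-1}u^{n-1}+u^n$. *)

theory Defs
  imports Complex_Main "HOL-Computational_Algebra.Polynomial"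
begin

text \<open>
  A unital Banach algebra is a type of sort \<open>{real_algebra_1, real_normed_algebra, banach}\<close>:
  complete, with submultiplicative norm and a unit different from 0. The class
  \<open>real_normed_algebra_1\<close> is avoided because it additionally demands \<open>norm 1 = 1\<close>. Real scalars
  cover complex Banach algebras by restriction of scalars.
\<close>

text \<open>
  The library's \<open>poly\<close> requires a commutative coefficient ring. Here coefficients stand
  to the left of the powers of the argument.
\<close>

definition left_eval :: "'a::ring_1 poly \<Rightarrow> 'a \<Rightarrow> 'a" where
  "left_eval p u = (\<Sum>i\<le>degree p. coeff p i * u ^ i)"

definition is_inverse_of :: "'a::ring_1 \<Rightarrow> 'a \<Rightarrow> bool" where
  "is_inverse_of v u \<longleftrightarrow> u * v = 1 \<and> v * u = 1"

definition invertible_elt :: "'a::ring_1 \<Rightarrow> bool" where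
  "invertible_elt u \<longleftrightarrow> (\<exists>v. is_inverse_of v u)"

definition inverse_elt :: "'a::ring_1 \<Rightarrow> 'a" where
  "inverse_elt u = (THE v. is_inverse_of v u)"

lemma is_inverse_of_unique:
  assumes "is_inverse_of v u" "is_inverse_of w u"
  shows "v = w"
proof -
  have "v = v * (u * w)" using assms by (simp add: is_inverse_of_def)
  also have "\<dots> = (v * u) * w" by (simp add: mult.assoc)
  also have "\<dots> = w" using assms by (simp add: is_inverse_of_def)
  finally show ?thesis .
qed

lemma inverse_elt_eqI: "is_inverse_of v u \<Longrightarrow> inverse_elt u = v"
  unfolding inverse_elt_def by (blast intro: is_inverse_of_unique)

lemma is_inverse_of_inverse_elt: "invertible_elt u \<Longrightarrow> is_inverse_of (inverse_elt u) u"
  unfolding invertible_elt_def by (auto simp: inverse_elt_eqI)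

lemma left_eval_monic:
  fixes a :: "nat \<Rightarrow> 'a::ring_1"
  shows "left_eval ((\<Sum>j<n. monom (a j) j) + monom 1 n) u = (\<Sum>j<n. a j * u ^ j) + u ^ n"
proof -
  let ?p = "(\<Sum>j<n. monom (a j) j) + monom 1 n"
  have c: "coeff ?p i = (if i < n then a i else if i = n then 1 else 0)" for i
    by (auto simp: coeff_sum sum.delta')
  have "degree ?p = n"
  proof (rule antisym)
    show "degree ?p \<le> n" by (rule degree_le) (simp only: c, auto)
    show "n \<le> degree ?p" by (rule le_degree) (simp only: c, simp)
  qed
  then have "left_eval ?p u = (\<Sum>i\<le>n. (if i < n then a i else if i = n then 1 else 0) * u ^ i)"
    unfolding left_eval_def by (simp only: c)
  also have "\<dots> = (\<Sum>j<n. a j * u ^ j) + u ^ n"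
    by (simp add: lessThan_Suc_atMost [symmetric])
  finally show ?thesis .
qed

end

theory Submission
  imports Defs
begin

text \<open>
  Write \<open>v\<close> for the inverse of \<open>u\<close>. If \<open>norm v \<ge> 1\<close>, the bound by 1 is immediate. Otherwise
  multiply \<open>p(u) = 0\<close> on the right by \<open>v ^ n\<close>; as the coefficients stand on the left, this gives
  \<open>1 = - (\<Sum>j<n. a j * v ^ (n - j))\<close> without any commutation between \<open>u\<close> and the
  coefficients. Every exponent \<open>n - j\<close> is at least 1, so each power of \<open>v\<close> has norm at most
  \<open>norm v\<close>, and hence \<open>1 \<le> norm 1 \<le> (\<Sum>j<n. norm (a j)) * norm v\<close>.
  The unit may have norm greater than 1, but it never has norm less than 1. Multiplying by
  \<open>v ^ n\<close> keeps the unit on the side where this lower bound is enough, and no zeroth power of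
  \<open>v\<close> has to be estimated from above.
\<close>

text \<open>
  The unit is a nonzero idempotent, so submultiplicativity bounds its norm by its own square.
\<close>

lemma one_le_norm_one: "1 \<le> norm (1::'a::{real_algebra_1, real_normed_algebra})"
  using norm_mult_ineq [of "1::'a" 1] by simp

text \<open>
  The zeroth power has to be excluded, as its norm may exceed 1.
\<close>

lemma norm_power_Suc_le_norm:
  fixes v :: "'a::{real_algebra_1, real_normed_algebra}"
  assumes "norm v \<le> 1"
  shows "norm (v ^ Suc k) \<le> norm v"
proof (induction k)
  case 0
  show ?case by simp
next
  case (Suc k)
  have "norm (v ^ Suc (Suc k)) \<le> norm v * norm (v ^ Suc k)"
    using norm_mult_ineq [of v "v ^ Suc k"] by simp
  also have "\<dots> \<le> norm v * 1"
    using Suc.IH assms by (intro mult_left_mono) auto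
  finally show ?case by simp
qed

lemma power_mult_power_right_inverse:
  fixes u v :: "'a::monoid_mult"
  assumes "u * v = 1"
  shows "u ^ j * v ^ (j + k) = v ^ k"
proof (induction j)
  case 0
  show ?case by simp
next
  case (Suc j)
  have "u ^ Suc j * v ^ (Suc j + k) = u ^ j * (u * v) * v ^ (j + k)"
    by (simp only: power_Suc2 [of u] power_Suc [of v] add_Suc mult.assoc)
  also have "\<dots> = v ^ k" using Suc.IH assms by simp
  finally show ?case .
qed

text \<open>
  Multiplying the equation \<open>p(u) = 0\<close> on the right by \<open>v ^ n\<close> moves every power of \<open>u\<close> into a
  power of \<open>v\<close>: the unit becomes a combination of positive powers of \<open>v\<close>.
\<close>

lemma one_eq_sum_powers_right_inverse:
  fixes a :: "nat \<Rightarrow> 'a::ring_1"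
  assumes "(\<Sum>j<n. a j * u ^ j) + u ^ n = 0" and "u * v = 1"
  shows "1 = - (\<Sum>j<n. a j * v ^ (n - j))"
proof -
  have "a j * u ^ j * v ^ n = a j * v ^ (n - j)" if "j < n" for j
    using power_mult_power_right_inverse [OF assms(2), of j "n - j"] that
    by (simp add: mult.assoc)
  then have "(\<Sum>j<n. a j * u ^ j) * v ^ n = (\<Sum>j<n. a j * v ^ (n - j))"
    by (simp add: sum_distrib_right)
  moreover have "u ^ n * v ^ n = 1"
    using power_mult_power_right_inverse [OF assms(2), of n 0] by simp
  ultimately have "(\<Sum>j<n. a j * v ^ (n - j)) + 1 = ((\<Sum>j<n. a j * u ^ j) + u ^ n) * v ^ n"
    by (simp add: distrib_right)
  then have "(\<Sum>j<n. a j * v ^ (n - j)) + 1 = 0"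
    using assms(1) by simp
  then show ?thesis by (simp add: eq_neg_iff_add_eq_0 add.commute)
qed

theorem theorem2p10:
  fixes a :: "nat \<Rightarrow> 'a::{real_algebra_1, real_normed_algebra, banach}"
    and u :: 'a and n :: nat and p :: "'a poly"
  assumes "n \<ge> 1"
    and "p = (\<Sum>j<n. monom (a j) j) + monom 1 n"
    and "left_eval p u = 0"
    and "invertible_elt u"
  shows "1 / norm (inverse_elt u) \<le> max 1 (\<Sum>j<n. norm (a j))"
proof -
  define v where "v = inverse_elt u"
  have uv: "u * v = 1"
    using is_inverse_of_inverse_elt [OF assms(4)] by (simp add: is_inverse_of_def v_def)
  then have v_pos: "0 < norm v" by auto
  show ?thesis
  proof (cases "1 \<le> norm v")
    case True
    then have "1 / norm v \<le> 1" using v_pos by (simp add: pos_divide_le_eq)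
    then show ?thesis by (simp add: v_def)
  next
    case False
    have root: "(\<Sum>j<n. a j * u ^ j) + u ^ n = 0"
      using assms(2,3) by (simp add: left_eval_monic)
    have summand: "norm (a j * v ^ (n - j)) \<le> norm (a j) * norm v" if "j < n" for j
    proof -
      have "norm (v ^ (n - j)) \<le> norm v"
        using norm_power_Suc_le_norm [of v "n - Suc j"] False that
        by (simp add: Suc_diff_Suc del: power_Suc)
      then show ?thesis
        using norm_mult_ineq [of "a j" "v ^ (n - j)"]
        by (meson mult_left_mono norm_ge_zero order_trans)
    qed
    have "1 \<le> norm (1::'a)" by (rule one_le_norm_one)
    also have "\<dots> = norm (\<Sum>j<n. a j * v ^ (n - j))"
      using one_eq_sum_powers_right_inverse [OF root uv] by (metis norm_minus_cancel)
    also have "\<dots> \<le> (\<Sum>j<n. norm (a j) * norm v)"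
      using summand by (intro sum_norm_le) auto
    also have "\<dots> = (\<Sum>j<n. norm (a j)) * norm v"
      by (simp add: sum_distrib_right)
    finally have "1 / norm v \<le> (\<Sum>j<n. norm (a j))"
      using v_pos by (simp add: pos_divide_le_eq)
    then show ?thesis by (simp add: v_def)
  qed
qed

end
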